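(* Let $1<p<\infty$. Every Cohen strongly $p$-summing multilinear operator is multiple Cohen strongly $p$-summing, and $\|\cdot\|_{mCoh,p}\le\|\cdot\|_{Coh,p}$. That is, for all $n\in\mathbb{N}$ and all Banach spaces $E_1,\dots,E_n,F$, one has $\mathcal{L}_{Coh,p}(E_1,\dots,E_n;F)\subset\mathcal{L}_{mCoh,p}(E_1,\dots,E_n;F)$ and $\|T\|_{mCoh,p}\le\|T\|_{Coh,p}$ for every $T\in\mathcal{L}_{Coh,p}(E_1,\dots,E_n;F)$.
   Context: $F'$ is the topological dual; $1/p+1/p^{*}=1$; $\mathcal{L}(E_1,\dots,E_n;F)$ is the space of continuous $n$-linear operators. For a countable family $(\varphi_i)_{i\in I}$ in $F'$, $\|(\varphi_i)_{i\in I}\|_{w,p^{*}}=\sup_{y\in B_F}\big(\sum_{i\in I}|\varphi_i(y)|^{p^{*}}\big)^{1/p^{*}}$, and $\ell_{p^{*}}^w(F')$ is the set of families for which this is finite. For $1\le q<\infty$, $\|(x_j)_j\|_q=(\sum_j\|x_j\|^q)^{1/q}$, and $\ell_q(E)$ is the space of sequences in $E$ for which this is finite. A family $(y_i)_{i\in I}$ in $F$ belongs to $\ell_p\langle F\rangle$ if $\sum_{i\in I}|\varphi_i(y_i)|<\infty$ for all $(\varphi_i)_{i\in I}\in\ell_{p^{*}}^w(F')$. $T\in\mathcal{L}(E_1,\dots,E_n;F)$ is Cohen strongly $p$-summing ($T\in\mathcal{L}_{Coh,p}(E_1,\dots,E_n;F)$) if $(T(x_i^{(1)},\dots,x_i^{(n)}))_{i=1}^\infty\in\ell_p\langle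 F\rangle$ whenever $(x_i^{(j)})_{i=1}^\infty\in\ell_{np}(E_j)$, $j=1,\dots,n$; $\|T\|_{Coh,p}$ is the smallest $C$ with $\sum_{i=1}^m|\varphi_i(T(x_i^{(1)},\dots,x_i^{(n)}))|\le C\prod_{j=1}^n\|(x_i^{(j)})_{i=1}^m\|_{np}\,\|(\varphi_i)_{i=1}^m\|_{w,p^{*}}$ for all $m\in\mathbb{N}$, $x_i^{(j)}\in E_j$, $\varphi_i\in F'$. $T$ is multiple Cohen strongly $p$-summing ($T\in\mathcal{L}_{mCoh,p}(E_1,\dots,E_n;F)$) if $\big(T(x_{j_1}^{(1)},\dots,x_{j_n}^{(n)})\big)_{(j_1,\dots,j_n)\in\mathbb{N}^n}\in\ell_p\langle F\rangle$ (families indexed by $\mathbb{N}^n$) whenever $(x_j^{(i)})_{j=1}^\infty\in\ell_p(E_i)$, $i=1,\dots,n$; $\|T\|_{mCoh,p}$ is the smallest $C$ with $$\sum_{j_1,\dots,j_n=1}^m\big|\varphi_{j_1,\dots,j_n}\big(T(x_{j_1}^{(1)},\dots,x_{j_n}^{(n)})\big)\big|\le C\prod_{i=1}^n\big\|(x_j^{(i)})_{j=1}^m\big\|_p\,\big\|(\varphi_{j_1,\dots,j_n})_{j_1,\dots,j_n=1}^m\big\|_{w,p^{*}}$$ for all $m\in\mathbb{N}$, $x_j^{(i)}\in E_i$, $\varphi_{j_1,\dots,j_n}\in F'$. *)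

theory Defs
  imports "HOL-Analysis.Analysis"
begin

text \<open>
  Banach spaces over a scalar field \<open>K\<close>. By the Gelfand--Mazur theorem a type of class
  \<open>real_normed_field\<close> is isometrically isomorphic to the reals or to the complex numbers, so
  both scalar fields are covered. Since a Banach space over \<open>K\<close> is a real Banach space by
  restriction of scalars, it is given by a type of class \<open>banach\<close> together with a
  multiplication by \<open>K\<close> that extends \<open>scaleR\<close> and is compatible with the norm.
\<close>

locale banach_over = vector_space scale
  for scale :: "'k::real_normed_field \<Rightarrow> 'a::banach \<Rightarrow> 'a" +
  assumes scale_of_real: "scale (of_real r) x = r *\<^sub>R x"
    and norm_scale: "norm (scale c x) = norm c * norm x"

definition conj_exponent :: "real \<Rightarrow> real" where
  "conj_exponent p = p / (p - 1)"

lemma conj_exponent_sum: "1 < p \<Longrightarrow> 1 / p + 1 / conj_exponent p = 1"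
  by (simp add: conj_exponent_def field_simps)

definition dual_space :: "('k::real_normed_field \<Rightarrow> 'f::banach \<Rightarrow> 'f) \<Rightarrow> ('f \<Rightarrow> 'k) set" where
  "dual_space sF = {\<phi>. Vector_Spaces.linear sF (*) \<phi> \<and> continuous_on UNIV \<phi>}"

definition lq_norm :: "real \<Rightarrow> 'i set \<Rightarrow> ('i \<Rightarrow> 'a::real_normed_vector) \<Rightarrow> real" where
  "lq_norm q I x = (\<Sum>\<^sub>\<infinity>i\<in>I. norm (x i) powr q) powr (1 / q)"

definition lq_space :: "real \<Rightarrow> 'a::real_normed_vector set \<Rightarrow> (nat \<Rightarrow> 'a) set" where
  "lq_space q E = {x. range x \<subseteq> E \<and> (\<lambda>j. norm (x j) powr q) summable_on UNIV}"

text \<open>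
  The real-valued supremum is the weak norm whenever the latter is finite, in particular on
  finite families in the dual; finiteness is what \<open>weak_lq_space\<close> requires.
\<close>

definition weak_norm ::
  "real \<Rightarrow> 'i set \<Rightarrow> ('i \<Rightarrow> 'f::real_normed_vector \<Rightarrow> 'k::real_normed_vector) \<Rightarrow> real" where
  "weak_norm q I \<phi> = (SUP y\<in>cball 0 1. (\<Sum>\<^sub>\<infinity>i\<in>I. norm (\<phi> i y) powr q) powr (1 / q))"

definition weak_lq_space ::
  "('k::real_normed_field \<Rightarrow> 'f::banach \<Rightarrow> 'f) \<Rightarrow> real \<Rightarrow> 'i set \<Rightarrow> ('i \<Rightarrow> 'f \<Rightarrow> 'k) set" where
  "weak_lq_space sF q I =
     {\<phi>. (\<forall>i\<in>I. \<phi> i \<in> dual_space sF) \<and>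
         (\<forall>y\<in>cball 0 1. (\<lambda>i. norm (\<phi> i y) powr q) summable_on I) \<and>
         bdd_above ((\<lambda>y. (\<Sum>\<^sub>\<infinity>i\<in>I. norm (\<phi> i y) powr q) powr (1 / q)) ` cball 0 1)}"

definition cohen_lp_space ::
  "('k::real_normed_field \<Rightarrow> 'f::banach \<Rightarrow> 'f) \<Rightarrow> real \<Rightarrow> 'i set \<Rightarrow> ('i \<Rightarrow> 'f) set" where
  "cohen_lp_space sF p I =
     {y. \<forall>\<phi>\<in>weak_lq_space sF (conj_exponent p) I. (\<lambda>i. norm (\<phi> i (y i))) summable_on I}"

text \<open>
  The spaces \<open>E 0, \<dots>, E (n - 1)\<close> are closed subspaces of one ambient Banach space. This is no
  restriction: \<open>n\<close> arbitrary Banach spaces are isometric to closed subspaces of their product.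
  Operators act on extensional tuples \<open>Pi\<^sub>E {..<n} E\<close>; their values elsewhere are irrelevant.
\<close>

definition multilinear_ops ::
  "('k::real_normed_field \<Rightarrow> 'a::banach \<Rightarrow> 'a) \<Rightarrow> ('k \<Rightarrow> 'f::banach \<Rightarrow> 'f) \<Rightarrow>
   nat \<Rightarrow> (nat \<Rightarrow> 'a set) \<Rightarrow> ((nat \<Rightarrow> 'a) \<Rightarrow> 'f) set" where
  "multilinear_ops sE sF n E =
     {T. (\<forall>i<n. \<forall>x\<in>Pi\<^sub>E {..<n} E. \<forall>u\<in>E i. \<forall>v\<in>E i.
            T (x(i := u + v)) = T (x(i := u)) + T (x(i := v))) \<and>
         (\<forall>i<n. \<forall>x\<in>Pi\<^sub>E {..<n} E. \<forall>u\<in>E i. \<forall>c.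
            T (x(i := sE c u)) = sF c (T (x(i := u)))) \<and>
         continuous_map (product_topology (\<lambda>i. top_of_set (E i)) {..<n}) euclidean T}"

definition cohen_ops ::
  "('k::real_normed_field \<Rightarrow> 'a::banach \<Rightarrow> 'a) \<Rightarrow> ('k \<Rightarrow> 'f::banach \<Rightarrow> 'f) \<Rightarrow>
   real \<Rightarrow> nat \<Rightarrow> (nat \<Rightarrow> 'a set) \<Rightarrow> ((nat \<Rightarrow> 'a) \<Rightarrow> 'f) set" where
  "cohen_ops sE sF p n E =
     {T \<in> multilinear_ops sE sF n E.
        \<forall>x. (\<forall>j<n. x j \<in> lq_space (real n * p) (E j)) \<longrightarrow>
            (\<lambda>i. T (\<lambda>j\<in>{..<n}. x j i)) \<in> cohen_lp_space sF p (UNIV :: nat set)}"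

text \<open>
  Both norms are the infimum in \<open>[0, \<infinity>]\<close> of the admissible constants. The condition \<open>0 \<le> C\<close> only
  matters if some \<open>E j\<close> or the codomain is trivial, when the inequality does not bound \<open>C\<close>.
\<close>

definition cohen_norm ::
  "('k::real_normed_field \<Rightarrow> 'f::banach \<Rightarrow> 'f) \<Rightarrow>
   real \<Rightarrow> nat \<Rightarrow> (nat \<Rightarrow> 'a::banach set) \<Rightarrow> ((nat \<Rightarrow> 'a) \<Rightarrow> 'f) \<Rightarrow> ennreal" where
  "cohen_norm sF p n E T = Inf (ennreal ` {C. 0 \<le> C \<and>
     (\<forall>(m::nat) x \<phi>. (\<forall>j<n. \<forall>i<m. x j i \<in> E j) \<longrightarrow> (\<forall>i<m. \<phi> i \<in> dual_space sF) \<longrightarrow>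
        (\<Sum>i<m. norm (\<phi> i (T (\<lambda>j\<in>{..<n}. x j i))))
          \<le> C * (\<Prod>j<n. lq_norm (real n * p) {..<m} (x j))
              * weak_norm (conj_exponent p) {..<m} \<phi>)})"

definition mcohen_ops ::
  "('k::real_normed_field \<Rightarrow> 'a::banach \<Rightarrow> 'a) \<Rightarrow> ('k \<Rightarrow> 'f::banach \<Rightarrow> 'f) \<Rightarrow>
   real \<Rightarrow> nat \<Rightarrow> (nat \<Rightarrow> 'a set) \<Rightarrow> ((nat \<Rightarrow> 'a) \<Rightarrow> 'f) set" where
  "mcohen_ops sE sF p n E =
     {T \<in> multilinear_ops sE sF n E.
        \<forall>x. (\<forall>i<n. x i \<in> lq_space p (E i)) \<longrightarrow>
            (\<lambda>j. T (\<lambda>i\<in>{..<n}. x i (j i))) \<in> cohen_lp_space sF p ({..<n} \<rightarrow>\<^sub>E (UNIV :: nat set))}"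

definition mcohen_norm ::
  "('k::real_normed_field \<Rightarrow> 'f::banach \<Rightarrow> 'f) \<Rightarrow>
   real \<Rightarrow> nat \<Rightarrow> (nat \<Rightarrow> 'a::banach set) \<Rightarrow> ((nat \<Rightarrow> 'a) \<Rightarrow> 'f) \<Rightarrow> ennreal" where
  "mcohen_norm sF p n E T = Inf (ennreal ` {C. 0 \<le> C \<and>
     (\<forall>(m::nat) x \<phi>. (\<forall>i<n. \<forall>j<m. x i j \<in> E i) \<longrightarrow>
        (\<forall>j \<in> {..<n} \<rightarrow>\<^sub>E {..<m}. \<phi> j \<in> dual_space sF) \<longrightarrow>
        (\<Sum>j \<in> {..<n} \<rightarrow>\<^sub>E {..<m}. norm (\<phi> j (T (\<lambda>i\<in>{..<n}. x i (j i)))))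
          \<le> C * (\<Prod>i<n. lq_norm p {..<m} (x i))
              * weak_norm (conj_exponent p) ({..<n} \<rightarrow>\<^sub>E {..<m}) \<phi>)})"

end

theory Submission
  imports Defs
begin

text \<open>
  The Cohen property concerns families in which all \<open>n\<close> arguments run along one index, and it
  measures each argument in \<open>\<ell>\<^bsub>np\<^esub>\<close>; the multiple property concerns all \<open>n\<close>-tuples of entries of
  \<open>n\<close> sequences, each measured in \<open>\<ell>\<^sub>p\<close>. The two are linked by the homogeneity of \<open>T\<close>. A tuple
  \<open>(v\<^sub>1, \<dots>, v\<^sub>n)\<close> of non-zero vectors may be rescaled by positive factors with product \<open>1\<close> without
  changing its image under \<open>T\<close>, and the factors can be chosen such that all entries get the same
  norm, namely the geometric mean \<open>(\<parallel>v\<^sub>1\<parallel> \<cdots> \<parallel>v\<^sub>n\<parallel>)\<^bsup>1/n\<^esup>\<close>. A tuple with a zero entry has image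
  \<open>0\<close>, and so has the zero tuple, whose entries also have the geometric mean as their norm
  (\<open>norm_balance\<close>, \<open>multilinear_balance\<close>).

  The \<open>np\<close>-th power of that norm is the product of the \<open>\<parallel>v\<^sub>i\<parallel>\<^sup>p\<close>, so for tuples of
  entries of sequences \<open>x\<^sup>1, \<dots>, x\<^sup>n\<close> the sum of these powers over all multi-indices factorises as \<open>\<Prod>\<^sub>i (\<Sum>\<^sub>j \<parallel>x\<^sup>i\<^sub>j\<parallel>\<^sup>p)\<close>. Its \<open>np\<close>-th root, multiplied over the \<open>n\<close>
  arguments, is exactly \<open>\<Prod>\<^sub>i \<parallel>x\<^sup>i\<parallel>\<^sub>p\<close> (\<open>balance_in_lq_space\<close>, \<open>prod_lq_norm_balance\<close>).

  Hence, after the multi-indices are enumerated by natural numbers, the Cohen property applied to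
  the balanced family is the multiple Cohen property of the original one, with the same constant.
\<close>

section \<open>Balancing a tuple\<close>

definition geom_mean_norm :: "nat \<Rightarrow> (nat \<Rightarrow> 'a::real_normed_vector) \<Rightarrow> real" where
  "geom_mean_norm n v = (\<Prod>i<n. norm (v i)) powr (1 / real n)"

definition balance :: "nat \<Rightarrow> (nat \<Rightarrow> 'a::real_normed_vector) \<Rightarrow> nat \<Rightarrow> 'a" where
  "balance n v i = (geom_mean_norm n v / norm (v i)) *\<^sub>R v i"

text \<open>
  This includes tuples with a vanishing entry: their geometric mean is \<open>0\<close>, so the whole balanced
  tuple is \<open>0\<close>.
\<close>

lemma norm_balance:
  assumes "i < n"
  shows "norm (balance n v i) = geom_mean_norm n v"
proof (cases "v i = 0")
  case True
  then have "(\<Prod>i<n. norm (v i)) = 0"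
    using assms by (intro prod_zero) auto
  with True show ?thesis by (simp add: balance_def geom_mean_norm_def)
next
  case False
  then show ?thesis by (simp add: balance_def geom_mean_norm_def)
qed

lemma norm_balance_powr:
  assumes "i < n"
  shows "norm (balance n v i) powr (real n * p) = (\<Prod>k<n. norm (v k) powr p)"
  using assms by (simp add: norm_balance geom_mean_norm_def powr_powr prod_powr_distrib)

lemma powr_power_pos: "1 \<le> n \<Longrightarrow> (s powr u) ^ n = s powr (real n * u)" for s :: real
  by (cases "s = 0") (auto simp: powr_power)

lemma prod_balance_factors:
  assumes "1 \<le> n" and "\<And>i. i < n \<Longrightarrow> v i \<noteq> 0"
  shows "(\<Prod>i<n. geom_mean_norm n v / norm (v i)) = 1"
proof -
  have pos: "0 < (\<Prod>i<n. norm (v i))"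
    using assms(2) by (intro prod_pos) auto
  have "geom_mean_norm n v ^ n = (\<Prod>i<n. norm (v i))"
    using assms(1) pos by (simp add: geom_mean_norm_def powr_power_pos)
  with pos assms(2) show ?thesis by (simp add: prod_dividef)
qed

lemma subspace_scaleR:
  assumes "banach_over s" and "module.subspace s S" and "x \<in> S"
  shows "r *\<^sub>R x \<in> S"
proof -
  interpret banach_over s by fact
  show ?thesis
    using subspace_scale[OF assms(2,3), of "of_real r"] by (simp only: scale_of_real)
qed

lemma multilinear_scaleR_prod:
  assumes E: "banach_over sE" and F: "banach_over sF"
    and sub: "\<forall>i<n. module.subspace sE (E i)"
    and T: "T \<in> multilinear_ops sE sF n E"
    and v: "\<And>i. i < n \<Longrightarrow> v i \<in> E i"
  shows "T (\<lambda>i\<in>{..<n}. c i *\<^sub>R v i) = (\<Prod>i<n. c i) *\<^sub>R T (\<lambda>i\<in>{..<n}. v i)"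
proof -
  have one: "T (x(i := r *\<^sub>R u)) = r *\<^sub>R T (x(i := u))"
    if "i < n" "x \<in> Pi\<^sub>E {..<n} E" "u \<in> E i" for i x u r
  proof -
    have "T (x(i := sE (of_real r) u)) = sF (of_real r) (T (x(i := u)))"
      using T that by (simp add: multilinear_ops_def)
    then show ?thesis
      by (simp add: banach_over.scale_of_real[OF E] banach_over.scale_of_real[OF F])
  qed
  have "T (\<lambda>i\<in>{..<n}. if i < m then c i *\<^sub>R v i else v i)
      = (\<Prod>i<m. c i) *\<^sub>R T (\<lambda>i\<in>{..<n}. v i)" if "m \<le> n" for m
    using that
  proof (induction m)
    case 0
    then show ?case by simp
  next
    case (Suc m)
    let ?x = "\<lambda>i\<in>{..<n}. if i < m then c i *\<^sub>R v i else v i"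
    have x: "?x \<in> Pi\<^sub>E {..<n} E"
      using v sub subspace_scaleR[OF E] by auto
    have "(\<lambda>i\<in>{..<n}. if i < Suc m then c i *\<^sub>R v i else v i) = ?x(m := c m *\<^sub>R v m)"
      using Suc.prems by (auto simp: fun_eq_iff less_Suc_eq)
    moreover have "?x(m := v m) = ?x"
      using Suc.prems by (auto simp: fun_eq_iff)
    moreover have "T (?x(m := c m *\<^sub>R v m)) = c m *\<^sub>R T (?x(m := v m))"
      using Suc.prems v by (intro one[OF _ x]) auto
    ultimately have "T (\<lambda>i\<in>{..<n}. if i < Suc m then c i *\<^sub>R v i else v i) = c m *\<^sub>R T ?x"
      by (simp only:)
    also have "T ?x = (\<Prod>i<m. c i) *\<^sub>R T (\<lambda>i\<in>{..<n}. v i)"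
      using Suc by (intro Suc.IH) simp
    finally show ?case by (simp only: scaleR_scaleR prod.lessThan_Suc mult.commute)
  qed
  from this[of n] show ?thesis
    by (simp add: restrict_def cong: if_cong)
qed

text \<open>
  If no entry vanishes, the scaling factors multiply to \<open>1\<close>. Otherwise both sides are \<open>0\<close>, since
  \<open>T\<close> vanishes on tuples with a zero entry.
\<close>

lemma multilinear_balance:
  assumes E: "banach_over sE" and F: "banach_over sF"
    and sub: "\<forall>i<n. module.subspace sE (E i)"
    and T: "T \<in> multilinear_ops sE sF n E"
    and v: "\<And>i. i < n \<Longrightarrow> v i \<in> E i" and n: "1 \<le> n"
  shows "T (\<lambda>i\<in>{..<n}. balance n v i) = T (\<lambda>i\<in>{..<n}. v i)"
proof -
  note scale = multilinear_scaleR_prod[where T = T and v = v, OF E F sub T v]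
  have eq: "T (\<lambda>i\<in>{..<n}. balance n v i)
      = (\<Prod>i<n. geom_mean_norm n v / norm (v i)) *\<^sub>R T (\<lambda>i\<in>{..<n}. v i)"
    unfolding balance_def by (rule scale)
  show ?thesis
  proof (cases "\<exists>i<n. v i = 0")
    case False
    then show ?thesis
      using eq prod_balance_factors[OF n, of v] by auto
  next
    case True
    then obtain i where i: "i < n" "v i = 0" by blast
    (* Scaling the zero entry by 0 leaves the tuple unchanged but annihilates its image. *)
    let ?c = "\<lambda>k. if k = i then 0 else 1 :: real"
    have "(\<lambda>k\<in>{..<n}. ?c k *\<^sub>R v k) = (\<lambda>k\<in>{..<n}. v k)"
      using i by (auto simp: fun_eq_iff)
    moreover have "(\<Prod>k<n. ?c k) = 0"
      using i by (intro prod_zero) auto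
    ultimately have "T (\<lambda>k\<in>{..<n}. v k) = 0"
      using scale[of ?c] by simp
    with eq show ?thesis by simp
  qed
qed

lemma balance_mem:
  assumes "banach_over sE" and "\<forall>i<n. module.subspace sE (E i)"
    and "v i \<in> E i" and "i < n"
  shows "balance n v i \<in> E i"
  using assms unfolding balance_def by (blast intro: subspace_scaleR)

section \<open>Sums over multi-indices\<close>

lemma summable_on_prod_PiE_nonneg:
  fixes f :: "'i \<Rightarrow> 'b \<Rightarrow> real"
  assumes "finite A" and "\<And>i. i \<in> A \<Longrightarrow> countable (B i)"
    and "\<And>i. i \<in> A \<Longrightarrow> f i summable_on B i"
    and "\<And>i b. i \<in> A \<Longrightarrow> b \<in> B i \<Longrightarrow> 0 \<le> f i b"
  shows "(\<lambda>g. \<Prod>i\<in>A. f i (g i)) summable_on Pi\<^sub>E A B"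
proof -
  have "Infinite_Set_Sum.abs_summable_on (f i) (B i)" if "i \<in> A" for i
  proof -
    have "(\<lambda>b. norm (f i b)) summable_on B i \<longleftrightarrow> f i summable_on B i"
      using assms(4) that by (intro summable_on_cong) auto
    then show ?thesis
      using assms(3) that unfolding abs_summable_equivalent by blast
  qed
  with assms(1,2) have "Infinite_Set_Sum.abs_summable_on (\<lambda>g. \<Prod>i\<in>A. f i (g i)) (Pi\<^sub>E A B)"
    by (intro abs_summable_on_prod_PiE)
  then show ?thesis
    by (metis abs_summable_equivalent abs_summable_summable)
qed

text \<open>
  The \<open>n\<close> arguments of the balanced family have equal norms, so each contributes the \<open>n\<close>-th root
  of the right-hand side.
\<close>

lemma prod_lq_norm_balance:
  fixes m :: nat
  assumes "1 \<le> n" and h: "bij_betw h I ({..<n} \<rightarrow>\<^sub>E {..<m})"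
  shows "(\<Prod>j<n. lq_norm (real n * p) I (\<lambda>k. balance n (\<lambda>i. x i (h k i)) j))
       = (\<Prod>i<n. lq_norm p {..<m} (x i))"
proof -
  let ?S = "\<Prod>i<n. \<Sum>j<m. norm (x i j) powr p"
  have "lq_norm (real n * p) I (\<lambda>k. balance n (\<lambda>i. x i (h k i)) j) = ?S powr (1 / (real n * p))"
    if "j < n" for j
  proof -
    have "(\<Sum>\<^sub>\<infinity>k\<in>I. norm (balance n (\<lambda>i. x i (h k i)) j) powr (real n * p))
        = (\<Sum>\<^sub>\<infinity>k\<in>I. \<Prod>i<n. norm (x i (h k i)) powr p)"
      using that by (simp add: norm_balance_powr)
    also have "\<dots> = (\<Sum>\<^sub>\<infinity>g\<in>{..<n} \<rightarrow>\<^sub>E {..<m}. \<Prod>i<n. norm (x i (g i)) powr p)"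
      by (rule infsum_reindex_bij_betw[OF h])
    also have "\<dots> = (\<Sum>g\<in>{..<n} \<rightarrow>\<^sub>E {..<m}. \<Prod>i<n. norm (x i (g i)) powr p)"
      by (intro infsum_finite finite_PiE) auto
    also have "\<dots> = ?S"
      by (intro prod_sum_PiE[symmetric]) auto
    finally show ?thesis by (simp add: lq_norm_def)
  qed
  then have "(\<Prod>j<n. lq_norm (real n * p) I (\<lambda>k. balance n (\<lambda>i. x i (h k i)) j))
      = (?S powr (1 / (real n * p))) ^ n"
    by simp
  also have "\<dots> = ?S powr (1 / p)"
    using assms(1) by (simp add: powr_power_pos)
  also have "\<dots> = (\<Prod>i<n. lq_norm p {..<m} (x i))"
    by (simp add: lq_norm_def prod_powr_distrib)
  finally show ?thesis .
qed

lemma balance_in_lq_space: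
  assumes E: "banach_over sE" and sub: "\<forall>i<n. module.subspace sE (E i)"
    and h: "bij_betw h UNIV ({..<n} \<rightarrow>\<^sub>E (UNIV :: nat set))"
    and x: "\<forall>i<n. x i \<in> lq_space p (E i)" and j: "j < n"
  shows "(\<lambda>k. balance n (\<lambda>i. x i (h k i)) j) \<in> lq_space (real n * p) (E j)"
proof -
  have "(\<lambda>g. \<Prod>i<n. norm (x i (g i)) powr p) summable_on ({..<n} \<rightarrow>\<^sub>E (UNIV :: nat set))"
    using x by (intro summable_on_prod_PiE_nonneg) (auto simp: lq_space_def)
  then have "(\<lambda>k. \<Prod>i<n. norm (x i (h k i)) powr p) summable_on UNIV"
    by (simp add: summable_on_reindex_bij_betw[OF h, of "\<lambda>g. \<Prod>i<n. norm (x i (g i)) powr p"])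
  moreover have "x j (h k j) \<in> E j" for k
    using x j by (auto simp: lq_space_def)
  ultimately show ?thesis
    using balance_mem[OF E sub] j by (auto simp: lq_space_def norm_balance_powr)
qed

lemma weak_norm_reindex:
  assumes "bij_betw h I J"
  shows "weak_norm q I (\<lambda>i. \<phi> (h i)) = weak_norm q J \<phi>"
  unfolding weak_norm_def
  by (simp add: infsum_reindex_bij_betw[OF assms, of "\<lambda>i. norm (\<phi> i y) powr q" for y])

lemma weak_lq_space_reindex:
  assumes "bij_betw h I J" and "\<phi> \<in> weak_lq_space sF q J"
  shows "(\<lambda>i. \<phi> (h i)) \<in> weak_lq_space sF q I"
  using assms(2) bij_betwE[OF assms(1)] unfolding weak_lq_space_def
  by (simp add: infsum_reindex_bij_betw[OF assms(1), of "\<lambda>i. norm (\<phi> i y) powr q" for y]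
      summable_on_reindex_bij_betw[OF assms(1), of "\<lambda>i. norm (\<phi> i y) powr q" for y])

lemma cohen_lp_space_reindex:
  assumes h: "bij_betw h I J" and y: "(\<lambda>i. y (h i)) \<in> cohen_lp_space sF p I"
  shows "y \<in> cohen_lp_space sF p J"
  unfolding cohen_lp_space_def
proof (intro CollectI ballI)
  fix \<phi> assume "\<phi> \<in> weak_lq_space sF (conj_exponent p) J"
  then have "(\<lambda>i. norm (\<phi> (h i) (y (h i)))) summable_on I"
    using y weak_lq_space_reindex[OF h] unfolding cohen_lp_space_def by force
  then show "(\<lambda>j. norm (\<phi> j (y j))) summable_on J"
    by (simp add: summable_on_reindex_bij_betw[OF h, of "\<lambda>j. norm (\<phi> j (y j))"])
qed

lemma ex_enumeration_of_multiindices: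
  assumes "1 \<le> n"
  obtains h :: "nat \<Rightarrow> nat \<Rightarrow> nat" where "bij_betw h UNIV ({..<n} \<rightarrow>\<^sub>E UNIV)"
proof -
  have "infinite ({..<n} \<rightarrow>\<^sub>E (UNIV :: nat set))"
    using assms by (auto simp: finite_PiE_iff PiE_eq_empty_iff intro: exI[of _ 0])
  moreover have "countable ({..<n} \<rightarrow>\<^sub>E (UNIV :: nat set))"
    by (intro countable_PiE) auto
  ultimately show thesis
    using that bij_betw_from_nat_into by blast
qed

section \<open>Cohen strongly summing operators are multiple Cohen strongly summing\<close>

lemma cohen_ops_subset_mcohen_ops:
  assumes n: "1 \<le> n" and E: "banach_over sE" and F: "banach_over sF"
    and sub: "\<forall>i<n. module.subspace sE (E i)"
  shows "cohen_ops sE sF p n E \<subseteq> mcohen_ops sE sF p n E"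
proof
  fix T assume T: "T \<in> cohen_ops sE sF p n E"
  then have ml: "T \<in> multilinear_ops sE sF n E"
    by (simp add: cohen_ops_def)
  have cohen: "\<forall>y. (\<forall>j<n. y j \<in> lq_space (real n * p) (E j)) \<longrightarrow>
      (\<lambda>k. T (\<lambda>j\<in>{..<n}. y j k)) \<in> cohen_lp_space sF p UNIV"
    using T by (simp add: cohen_ops_def)
  obtain h :: "nat \<Rightarrow> nat \<Rightarrow> nat" where h: "bij_betw h UNIV ({..<n} \<rightarrow>\<^sub>E UNIV)"
    using ex_enumeration_of_multiindices[OF n] .
  have "(\<lambda>j. T (\<lambda>i\<in>{..<n}. x i (j i))) \<in> cohen_lp_space sF p ({..<n} \<rightarrow>\<^sub>E (UNIV :: nat set))"
    if x: "\<forall>i<n. x i \<in> lq_space p (E i)" for x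
  proof (rule cohen_lp_space_reindex[OF h])
    have "(\<lambda>k. T (\<lambda>i\<in>{..<n}. balance n (\<lambda>i. x i (h k i)) i)) \<in> cohen_lp_space sF p UNIV"
      by (rule cohen[rule_format]) (rule balance_in_lq_space[OF E sub h x])
    moreover have "T (\<lambda>i\<in>{..<n}. balance n (\<lambda>i. x i (h k i)) i) = T (\<lambda>i\<in>{..<n}. x i (h k i))" for k
      using x by (intro multilinear_balance[OF E F sub ml _ n]) (auto simp: lq_space_def)
    ultimately show "(\<lambda>k. T (\<lambda>i\<in>{..<n}. x i (h k i))) \<in> cohen_lp_space sF p UNIV"
      by simp
  qed
  with ml show "T \<in> mcohen_ops sE sF p n E"
    by (simp add: mcohen_ops_def)
qed

text \<open>
  The assumption on \<open>C\<close> ranges over all lengths of families, since the \<open>m\<^sup>n\<close> multi-indices below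
  \<open>m\<close> are enumerated as one family of that length.
\<close>

lemma multiple_cohen_inequality:
  fixes m :: nat
  assumes n: "1 \<le> n" and E: "banach_over sE" and F: "banach_over sF"
    and sub: "\<forall>i<n. module.subspace sE (E i)"
    and T: "T \<in> multilinear_ops sE sF n E"
    and C: "\<And>(m::nat) x \<phi>. \<forall>j<n. \<forall>i<m. x j i \<in> E j \<Longrightarrow> \<forall>i<m. \<phi> i \<in> dual_space sF \<Longrightarrow>
        (\<Sum>i<m. norm (\<phi> i (T (\<lambda>j\<in>{..<n}. x j i))))
          \<le> C * (\<Prod>j<n. lq_norm (real n * p) {..<m} (x j))
              * weak_norm (conj_exponent p) {..<m} \<phi>"
    and x: "\<forall>i<n. \<forall>j<m. x i j \<in> E i"
    and \<phi>: "\<forall>j \<in> {..<n} \<rightarrow>\<^sub>E {..<m}. \<phi> j \<in> dual_space sF"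
  shows "(\<Sum>j \<in> {..<n} \<rightarrow>\<^sub>E {..<m}. norm (\<phi> j (T (\<lambda>i\<in>{..<n}. x i (j i)))))
          \<le> C * (\<Prod>i<n. lq_norm p {..<m} (x i))
              * weak_norm (conj_exponent p) ({..<n} \<rightarrow>\<^sub>E {..<m}) \<phi>"
proof -
  let ?J = "{..<n} \<rightarrow>\<^sub>E {..<m}"
  have "finite ?J" by (intro finite_PiE) auto
  then obtain h where h: "bij_betw h {..<card ?J} ?J"
    using bij_betw_from_nat_into_finite by blast
  let ?y = "\<lambda>j k. balance n (\<lambda>i. x i (h k i)) j"
  have entry: "x i (h k i) \<in> E i" if "k < card ?J" "i < n" for i k
    using bij_betwE[OF h] that x by (auto simp: PiE_iff)
  have bal: "T (\<lambda>i\<in>{..<n}. ?y i k) = T (\<lambda>i\<in>{..<n}. x i (h k i))" if "k < card ?J" for k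
    using that entry by (intro multilinear_balance[OF E F sub T _ n])
  have "(\<Sum>j\<in>?J. norm (\<phi> j (T (\<lambda>i\<in>{..<n}. x i (j i)))))
      = (\<Sum>k<card ?J. norm (\<phi> (h k) (T (\<lambda>i\<in>{..<n}. x i (h k i)))))"
    by (rule sum.reindex_bij_betw[OF h, symmetric])
  also have "\<dots> = (\<Sum>k<card ?J. norm (\<phi> (h k) (T (\<lambda>i\<in>{..<n}. ?y i k))))"
    by (intro sum.cong) (simp_all add: bal)
  also have "\<dots> \<le> C * (\<Prod>j<n. lq_norm (real n * p) {..<card ?J} (?y j))
      * weak_norm (conj_exponent p) {..<card ?J} (\<lambda>k. \<phi> (h k))"
    using bij_betwE[OF h] \<phi> entry by (intro C) (auto intro: balance_mem[OF E sub])
  also have "\<dots> = C * (\<Prod>i<n. lq_norm p {..<m} (x i)) * weak_norm (conj_exponent p) ?J \<phi>"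
    by (simp only: prod_lq_norm_balance[OF n h] weak_norm_reindex[OF h])
  finally show ?thesis .
qed

theorem proposition4p4:
  fixes sE :: "'k::real_normed_field \<Rightarrow> 'a::banach \<Rightarrow> 'a"
    and sF :: "'k \<Rightarrow> 'f::banach \<Rightarrow> 'f"
    and E :: "nat \<Rightarrow> 'a set"
    and n :: nat
    and p :: real
  assumes "1 < p"
    and "1 \<le> n"
    and "banach_over sE"
    and "banach_over sF"
    and "\<forall>i<n. module.subspace sE (E i) \<and> closed (E i)"
  shows "cohen_ops sE sF p n E \<subseteq> mcohen_ops sE sF p n E \<and>
         (\<forall>T \<in> cohen_ops sE sF p n E. mcohen_norm sF p n E T \<le> cohen_norm sF p n E T)"
proof (intro conjI ballI)
  have sub: "\<forall>i<n. module.subspace sE (E i)"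
    using assms(5) by blast
  show "cohen_ops sE sF p n E \<subseteq> mcohen_ops sE sF p n E"
    by (rule cohen_ops_subset_mcohen_ops[OF assms(2-4) sub])
  fix T assume "T \<in> cohen_ops sE sF p n E"
  then have ml: "T \<in> multilinear_ops sE sF n E"
    by (simp add: cohen_ops_def)
  (* Both norms are infima of sets of constants, so it suffices to include one set in the other. *)
  show "mcohen_norm sF p n E T \<le> cohen_norm sF p n E T"
    unfolding mcohen_norm_def cohen_norm_def
  proof (intro Inf_superset_mono image_mono subsetI CollectI conjI allI impI)
    fix C :: real and m :: nat and x :: "nat \<Rightarrow> nat \<Rightarrow> 'a" and \<phi> :: "(nat \<Rightarrow> nat) \<Rightarrow> 'f \<Rightarrow> 'k"
    assume C: "C \<in> {C. 0 \<le> C \<and>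
      (\<forall>(m::nat) x \<phi>. (\<forall>j<n. \<forall>i<m. x j i \<in> E j) \<longrightarrow> (\<forall>i<m. \<phi> i \<in> dual_space sF) \<longrightarrow>
        (\<Sum>i<m. norm (\<phi> i (T (\<lambda>j\<in>{..<n}. x j i))))
          \<le> C * (\<Prod>j<n. lq_norm (real n * p) {..<m} (x j))
              * weak_norm (conj_exponent p) {..<m} \<phi>)}"
    then show "0 \<le> C" by simp
    assume "\<forall>i<n. \<forall>j<m. x i j \<in> E i" and "\<forall>j \<in> {..<n} \<rightarrow>\<^sub>E {..<m}. \<phi> j \<in> dual_space sF"
    then show "(\<Sum>j \<in> {..<n} \<rightarrow>\<^sub>E {..<m}. norm (\<phi> j (T (\<lambda>i\<in>{..<n}. x i (j i)))))
        \<le> C * (\<Prod>i<n. lq_norm p {..<m} (x i))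
            * weak_norm (conj_exponent p) ({..<n} \<rightarrow>\<^sub>E {..<m}) \<phi>"
      by (intro multiple_cohen_inequality[OF assms(2-4) sub ml]) (use C in blast)+
  qed
qed

end
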